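(* For every positive integer $n$ and every $J\subseteq[n-2]$, \[\sum_{\pi\in C_nD_{n-1,J}^{-1}}\mathbf{x}^{\mathrm{cDes}(\pi)}t^{\pi^{-1}(n)}=\sum_{\pi\in D_{n-1,J}^{-1}C_n}\mathbf{x}^{\mathrm{cDes}(\pi)}t^{\pi^{-1}(n)}.\]
   Context: Permutations are written in one-line notation and composed right to left, $(\sigma\tau)(i)=\sigma(\tau(i))$. For $\pi\in\mathfrak{S}_n$, $\mathrm{Des}(\pi)=\{i\in[n-1]:\pi(i)>\pi(i+1)\}$ and $\mathrm{cDes}(\pi)=\{i\in[n]:\pi(i)>\pi(i+1)\}$ with the convention $\pi(n+1):=\pi(1)$. For $J\subseteq[n]$, $\mathbf{x}^J=\prod_{i\in J}x_i$; $t$ is an additional variable. Let $c_n=(1,2,\dots,n)=23\cdots n1$ and $C_n=\langle c_n\rangle$. $D_{n-1,J}=\{\pi\in\mathfrak{S}_{n-1}:\mathrm{Des}(\pi)=J\}$, $D_{n-1,J}^{-1}=\{\pi^{-1}:\pi\in D_{n-1,J}\}$, viewed as a subset of $\mathfrak{S}_n$ by identifying $\mathfrak{S}_{n-1}$ with the permutations of $\mathfrak{S}_n$ fixing $n$. For $A\subseteq\mathfrak{S}_n$, $C_nA=\{c\sigma: c\in C_n,\sigma\in A\}$ and $AC_n=\{\sigma c:\sigma\in A,c\in C_n\}$. *)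

theory Defs
  imports "HOL-Combinatorics.Permutations"
begin

text \<open>Permutations of [n] = {1..n} are functions nat => nat with p permutes {1..n};
  composition right to left is function composition.\<close>

definition cyc :: "nat \<Rightarrow> nat \<Rightarrow> nat" where
  "cyc n i = (if 1 \<le> i \<and> i < n then i + 1 else if i = n then 1 else i)"

definition cycgrp :: "nat \<Rightarrow> (nat \<Rightarrow> nat) set" where
  "cycgrp n = {cyc n ^^ k | k. k < n}"

definition Des :: "nat \<Rightarrow> (nat \<Rightarrow> nat) \<Rightarrow> nat set" where
  "Des n p = {i \<in> {1..n-1}. p i > p (i + 1)}"

definition cDes :: "nat \<Rightarrow> (nat \<Rightarrow> nat) \<Rightarrow> nat set" where
  "cDes n p = {i \<in> {1..n}. p i > p (if i = n then 1 else i + 1)}"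

definition xmon :: "(nat \<Rightarrow> 'a::comm_ring_1) \<Rightarrow> nat set \<Rightarrow> 'a" where
  "xmon x J = (\<Prod>i\<in>J. x i)"

definition Dset :: "nat \<Rightarrow> nat set \<Rightarrow> (nat \<Rightarrow> nat) set" where
  "Dset m J = {p. p permutes {1..m} \<and> Des m p = J}"

definition Dinv :: "nat \<Rightarrow> nat set \<Rightarrow> (nat \<Rightarrow> nat) set" where
  "Dinv m J = inv ` Dset m J"

definition lmul :: "(nat \<Rightarrow> nat) set \<Rightarrow> (nat \<Rightarrow> nat) set \<Rightarrow> (nat \<Rightarrow> nat) set" where
  "lmul A B = {a \<circ> b | a b. a \<in> A \<and> b \<in> B}"

end

(* Let c = cyc n. For s in S_(n-1) and p in [n], the permutation w = c^(n - s p) s c^p again fixes n, and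
   c^(n - s p) s = w c^(n - p). Both sums therefore run over products w c^(n - p), whose n stands at
   position p and whose cyclic descent set is a rotation of Des w together with n; on the right w is
   s itself. So it is enough that, for each p, Des w and Des s are equidistributed over the s whose
   inverse has descent set J.

   By inclusion-exclusion one may count the s with Des (s^-1) in J and Des w in I. Such an s is the
   standardization of the word of its J-blocks. Rotate this word so that its letter m at p goes to the
   position q = n - p of n in s c^p. Within an I-block, Des w in I then says that the letters are sorted
   for the order in which the values of w follow each other: m < m+1 < ... < 1 < ... < m-1 before q, and
   m+1 < ... < 1 < ... < m after q; the block of q itself is a cyclic rotation of a sorted word. Hence s
   corresponds to the family of multisets of letters in the I-blocks, each of which occurs exactly once:
   m is recovered from the block of q, and then all the blocks can be sorted. The same families
   describe the s with Des s in I. *)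

theory Submission
  imports Defs "HOL-Library.Multiset" "HOL-Library.Product_Lexorder"
begin

section \<open>Blocks of positions and words sorted on them\<close>

text \<open>Cutting after each element of \<open>I\<close> puts \<open>i\<close> and
  \<open>i + 1\<close> into one block exactly when \<open>i\<close> is not in \<open>I\<close>.
  Applied to values instead of positions, the same number serves as the letter that \<open>J\<close>
  assigns to a value.\<close>

definition blk :: "nat set \<Rightarrow> nat \<Rightarrow> nat" where
  "blk I i = card {j \<in> I. j < i}"

text \<open>A \<open>k\<close> that numbers no block gives the empty list, so conditions on blocks
  may range over all \<open>k\<close>.\<close>

definition blist :: "nat \<Rightarrow> nat set \<Rightarrow> nat \<Rightarrow> nat list" where
  "blist N I k = filter (\<lambda>i. blk I i = k) [1..<Suc N]"

lemma blk_mono: "i \<le> j \<Longrightarrow> blk I i \<le> blk I j"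
  unfolding blk_def by (rule card_mono) auto

lemma blk_Suc: "blk I (Suc i) = (if i \<in> I then Suc (blk I i) else blk I i)"
proof -
  have "{j \<in> I. j < Suc i} = (if i \<in> I then insert i {j \<in> I. j < i} else {j \<in> I. j < i})"
    by (auto simp: less_Suc_eq)
  then show ?thesis by (auto simp: blk_def)
qed

lemma set_blist: "set (blist N I k) = {i \<in> {1..N}. blk I i = k}"
  by (auto simp: blist_def)

lemma blist_strict: "sorted_wrt (<) (blist N I k)"
  unfolding blist_def by (rule sorted_wrt_filter[OF sorted_wrt_upt])

lemma distinct_blist: "distinct (blist N I k)"
  by (simp add: blist_def)

lemma blist_split:
  assumes "1 \<le> q" "q \<le> N"
  obtains as bs where "blist N I (blk I q) = as @ q # bs"
    "\<And>i. i \<in> set as \<Longrightarrow> i < q" "\<And>i. i \<in> set bs \<Longrightarrow> q < i"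
proof -
  have "q \<in> set (blist N I (blk I q))" using assms by (simp add: set_blist)
  then obtain as bs where s: "blist N I (blk I q) = as @ q # bs" by (meson split_list)
  have "sorted_wrt (<) (as @ q # bs)" using blist_strict s by metis
  then show thesis using that[OF s] by (auto simp: sorted_wrt_append)
qed

lemma sorted_blist_D:
  fixes K :: "nat \<Rightarrow> 'b::linorder"
  assumes "\<And>k. sorted (map K (blist N I k))" "1 \<le> i" "i \<le> j" "j \<le> N" "blk I i = blk I j"
  shows "K i \<le> K j"
proof (cases "i = j")
  case False
  have "i \<le> N" using assms by simp
  then obtain as bs where s: "blist N I (blk I i) = as @ i # bs"
      and as: "\<And>j. j \<in> set as \<Longrightarrow> j < i" by (metis blist_split assms(2))
  have "j \<in> set (blist N I (blk I i))" using assms by (auto simp: set_blist)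
  then have "j \<in> set bs" using s as[of j] False assms(3) by auto
  moreover have "sorted (map K (as @ i # bs))" using assms(1) s by metis
  ultimately show ?thesis by (simp add: sorted_append)
qed simp

text \<open>Inside a block no position is separated from the next by an element of \<open>I\<close>,
  so weak ascents chain up by transitivity. The order of \<open>K\<close> is arbitrary because
  values, letters and the pairs of \<open>rkey\<close> are all compared this way.\<close>

lemma weak_ascents_iff_sorted_blocks:
  fixes K :: "nat \<Rightarrow> 'b::linorder"
  shows "(\<forall>i\<in>{1..N-1}. i \<notin> I \<longrightarrow> K i \<le> K (i + 1)) \<longleftrightarrow> (\<forall>k. sorted (map K (blist N I k)))"
    (is "?L \<longleftrightarrow> ?R")
proof
  assume L: ?L
  have step: "K i \<le> K j" if "i \<le> j" "1 \<le> i" "j \<le> N" "blk I i = blk I j" for i j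
    using that
  proof (induction j rule: dec_induct)
    case base then show ?case by simp
  next
    case (step j)
    have "blk I i \<le> blk I j" "blk I j \<le> blk I (Suc j)"
      using step.hyps by (auto intro: blk_mono)
    then have e: "blk I i = blk I j" "blk I j = blk I (Suc j)" using step.prems by auto
    then have "j \<notin> I" by (auto simp: blk_Suc)
    then have "K j \<le> K (Suc j)" using L step by auto
    moreover have "K i \<le> K j" using step e by auto
    ultimately show ?case by simp
  qed
  show ?R
  proof
    fix k
    have "sorted_wrt (\<lambda>i j. K i \<le> K j) (blist N I k)"
      by (rule sorted_wrt_mono_rel[OF _ blist_strict]) (auto simp: set_blist intro: step)
    then show "sorted (map K (blist N I k))" by (simp add: sorted_wrt_map)
  qed
next
  assume R: ?R
  show ?L
  proof (intro ballI impI)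
    fix i assume "i \<in> {1..N-1}" "i \<notin> I"
    then show "K i \<le> K (i + 1)"
      using R by (intro sorted_blist_D[of K N I]) (auto simp: blk_Suc)
  qed
qed

lemma mset_map_partition:
  assumes "finite F" "g ` set xs \<subseteq> F"
  shows "mset (map z xs) = (\<Sum>k\<in>F. mset (map z (filter (\<lambda>i. g i = k) xs)))"
  using assms(2)
proof (induction xs)
  case (Cons a xs)
  have "(\<Sum>k\<in>F. mset (map z (filter (\<lambda>i. g i = k) (a # xs))))
      = (\<Sum>k\<in>F. (if g a = k then {#z a#} else {#}) + mset (map z (filter (\<lambda>i. g i = k) xs)))"
    by (rule sum.cong) auto
  also have "\<dots> = {#z a#} + mset (map z xs)"
    using Cons assms(1) by (simp add: sum.distrib sum.delta')
  finally show ?case by simp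
qed simp

lemma mset_map_cong_blocks:
  assumes "\<And>k. mset (map z (blist N I k)) = mset (map z' (blist N I k))"
  shows "mset (map z [1..<Suc N]) = mset (map z' [1..<Suc N])"
proof -
  let ?F = "blk I ` set [1..<Suc N]"
  show ?thesis
    using assms
    by (simp add: mset_map_partition[of ?F "blk I"] blist_def del: mset_map set_upt upt_Suc)
qed

text \<open>The blocks are disjoint, so a word can be prescribed on each of them independently;
  equal multisets supply the matching lengths.\<close>

lemma place_blocks:
  assumes "\<And>k. mset (l k) = mset (map z (blist N I k))"
  shows "\<exists>z'. \<forall>k. map z' (blist N I k) = l k"
proof -
  define z' where "z' i = the (map_of (zip (blist N I (blk I i)) (l (blk I i))) i)" for i
  have "map z' (blist N I k) = l k" for k
  proof (rule nth_equalityI)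
    have len: "length (l k) = length (blist N I k)"
      using mset_eq_length[OF assms[of k]] by simp
    then show "length (map z' (blist N I k)) = length (l k)" by simp
    fix a assume "a < length (map z' (blist N I k))"
    then have a: "a < length (blist N I k)" by simp
    then have "blk I (blist N I k ! a) = k" using nth_mem[OF a] by (simp add: set_blist)
    then show "map z' (blist N I k) ! a = l k ! a"
      using a len by (simp add: z'_def map_of_zip_nth distinct_blist)
  qed
  then show ?thesis by blast
qed

lemma eq_on_blocks:
  assumes "\<And>k. map z (blist N I k) = map z' (blist N I k)" "i \<in> {1..N}"
  shows "z i = z' i"
proof -
  have "i \<in> set (blist N I (blk I i))" using assms(2) by (simp add: set_blist)
  then show ?thesis using assms(1)[of "blk I i"] by auto
qed

lemma sorted_mset_unique:
  "sorted xs \<Longrightarrow> sorted ys \<Longrightarrow> mset xs = mset ys \<Longrightarrow> xs = ys"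
  by (metis properties_for_sort)

lemma sorted_key_mset_unique:
  assumes "sorted (map f xs)" "sorted (map f ys)" "mset xs = mset ys" "inj f"
  shows "xs = ys"
proof -
  have "map f xs = map f ys" using assms by (intro sorted_mset_unique) auto
  then show ?thesis using assms(4) by (simp add: inj_map_eq_map)
qed

section \<open>Rotated orders of the letters\<close>

text \<open>First component 0 marks letters whose values the rotation puts below the image of the
  value \<open>n\<close>, and 2 those it puts above.\<close>

definition keyL :: "nat \<Rightarrow> nat \<Rightarrow> nat \<times> nat" where
  "keyL m a = (if m \<le> a then (0, a) else (2, a))"

definition keyR :: "nat \<Rightarrow> nat \<Rightarrow> nat \<times> nat" where
  "keyR m a = (if a \<le> m then (2, a) else (0, a))"

text \<open>In the word rotated to put the letter of position \<open>p\<close> at \<open>q\<close>, a letter equal to \<open>z q\<close> before \<open>q\<close>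
  comes from a position after \<open>p\<close>, hence from a larger value, and one after \<open>q\<close> from a smaller value; this
  is why ties are broken differently in \<open>keyL\<close> and \<open>keyR\<close>. The pair \<open>(1, 0)\<close> stands for the value \<open>n\<close>.\<close>

definition rkey :: "nat \<Rightarrow> (nat \<Rightarrow> nat) \<Rightarrow> nat \<Rightarrow> nat \<times> nat" where
  "rkey q z i = (if i < q then keyL (z q) (z i) else if i = q then (1, 0) else keyR (z q) (z i))"

lemma inj_keyL: "inj (keyL m)" and inj_keyR: "inj (keyR m)"
  by (auto simp: inj_on_def keyL_def keyR_def split: if_splits)

text \<open>Comparison with \<open>(1, 0)\<close> forces the letters before \<open>q\<close> to be
  at least \<open>z q\<close> and those after \<open>q\<close> to be at most \<open>z q\<close>; on
  either side the key then agrees with the usual order. Exchanging the two sides therefore gives a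
  sorted word.\<close>

lemma sorted_rkey_middle:
  assumes "blist N I (blk I q) = as @ q # bs"
    "\<And>i. i \<in> set as \<Longrightarrow> i < q" "\<And>i. i \<in> set bs \<Longrightarrow> q < i"
  shows "sorted (map (rkey q z) (blist N I (blk I q))) \<longleftrightarrow> sorted (map z bs @ z q # map z as)"
proof -
  have A: "map (rkey q z) as = map (\<lambda>i. keyL (z q) (z i)) as"
    using assms(2) by (auto simp: rkey_def)
  have B: "map (rkey q z) bs = map (\<lambda>i. keyR (z q) (z i)) bs"
    using assms(3) by (fastforce simp: rkey_def)
  have Lle: "keyL (z q) a \<le> (1, 0) \<longleftrightarrow> z q \<le> a" for a by (auto simp: keyL_def)
  have Rge: "(1, 0) \<le> keyR (z q) a \<longleftrightarrow> a \<le> z q" for a by (auto simp: keyR_def)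
  have q: "rkey q z q = (1, 0)" by (simp add: rkey_def)
  have SA: "sorted (map (\<lambda>i. keyL (z q) (z i)) as) \<longleftrightarrow> sorted (map z as)"
    if "\<forall>i\<in>set as. z q \<le> z i"
    using that by (induction as) (auto simp: keyL_def)
  have SB: "sorted (map (\<lambda>i. keyR (z q) (z i)) bs) \<longleftrightarrow> sorted (map z bs)"
    if "\<forall>i\<in>set bs. z i \<le> z q"
    using that by (induction bs) (auto simp: keyR_def)
  have "sorted (map (rkey q z) (blist N I (blk I q))) \<longleftrightarrow>
     sorted (map (\<lambda>i. keyL (z q) (z i)) as) \<and> sorted (map (\<lambda>i. keyR (z q) (z i)) bs) \<and>
     (\<forall>i\<in>set as. z q \<le> z i) \<and> (\<forall>i\<in>set bs. z i \<le> z q)"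
    unfolding assms(1) map_append list.map A B q
    by (auto simp: sorted_append simp flip: Lle Rge) (meson Lle Rge order_trans)+
  also have "\<dots> \<longleftrightarrow> sorted (map z bs @ z q # map z as)"
    using SA SB by (auto simp: sorted_append) (meson order_trans)+
  finally show ?thesis .
qed

text \<open>A block other than that of \<open>q\<close> lies wholly on one side of \<open>q\<close>,
  so a single injective key governs it.\<close>

lemma map_rkey_side:
  shows "k < blk I q \<Longrightarrow> map (rkey q z) (blist N I k) = map (keyL (z q)) (map z (blist N I k))"
    and "blk I q < k \<Longrightarrow> map (rkey q z) (blist N I k) = map (keyR (z q)) (map z (blist N I k))"
proof -
  assume "k < blk I q"
  then have "i < q" if "i \<in> set (blist N I k)" for i
    using that blk_mono[of q i I] by (fastforce simp: set_blist not_le[symmetric])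
  then show "map (rkey q z) (blist N I k) = map (keyL (z q)) (map z (blist N I k))"
    by (auto simp: rkey_def)
next
  assume "blk I q < k"
  then have "q < i" if "i \<in> set (blist N I k)" for i
    using that blk_mono[of i q I] by (fastforce simp: set_blist not_le[symmetric])
  then show "map (rkey q z) (blist N I k) = map (keyR (z q)) (map z (blist N I k))"
    by (fastforce simp: rkey_def)
qed

text \<open>The block of \<open>q\<close> is settled first: up to exchanging its two sides it is the
  sorted list of its letters. This reveals \<open>z q\<close>, hence the orders for all other
  blocks, where sorting for an injective key leaves no choice.\<close>

lemma rkey_sorted_unique:
  assumes q: "1 \<le> q" "q \<le> N"
    and z: "\<And>k. sorted (map (rkey q z) (blist N I k))"
    and z': "\<And>k. sorted (map (rkey q z') (blist N I k))"
    and M: "\<And>k. mset (map z (blist N I k)) = mset (map z' (blist N I k))"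
    and i: "i \<in> {1..N}"
  shows "z i = z' i"
proof (rule eq_on_blocks[OF _ i])
  fix k
  obtain as bs where s: "blist N I (blk I q) = as @ q # bs"
    "\<And>i. i \<in> set as \<Longrightarrow> i < q" "\<And>i. i \<in> set bs \<Longrightarrow> q < i" using blist_split[OF q, where I = I] by blast
  have "map z bs @ z q # map z as = map z' bs @ z' q # map z' as"
  proof (rule sorted_mset_unique)
    show "sorted (map z bs @ z q # map z as)" using z sorted_rkey_middle[OF s] by blast
    show "sorted (map z' bs @ z' q # map z' as)" using z' sorted_rkey_middle[OF s] by blast
    show "mset (map z bs @ z q # map z as) = mset (map z' bs @ z' q # map z' as)"
      using M[of "blk I q"] unfolding s(1) by (simp add: ac_simps)
  qed
  \<comment> \<open>Corresponding parts have equal lengths, so the equation splits part by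
    part.\<close>
  then have e: "map z bs = map z' bs" "z q = z' q" "map z as = map z' as" by auto
  consider "k < blk I q" | "k = blk I q" | "blk I q < k" by linarith
  then show "map z (blist N I k) = map z' (blist N I k)"
  proof cases
    case 1
    then show ?thesis
      using z[of k] z'[of k] M[of k] e(2)
      by (intro sorted_key_mset_unique[OF _ _ _ inj_keyL[of "z q"]]) (simp_all only: map_rkey_side)
  next
    case 2 then show ?thesis using s e by auto
  next
    case 3
    then show ?thesis
      using z[of k] z'[of k] M[of k] e(2)
      by (intro sorted_key_mset_unique[OF _ _ _ inj_keyR[of "z q"]]) (simp_all only: map_rkey_side)
  qed
qed

lemma rkey_sorted_exists:
  assumes q: "1 \<le> q" "q \<le> N"
  shows "\<exists>z'. (\<forall>k. sorted (map (rkey q z') (blist N I k))) \<and>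
     (\<forall>k. mset (map z' (blist N I k)) = mset (map z (blist N I k)))"
proof -
  obtain as bs where s: "blist N I (blk I q) = as @ q # bs"
    "\<And>i. i \<in> set as \<Longrightarrow> i < q" "\<And>i. i \<in> set bs \<Longrightarrow> q < i" using blist_split[OF q, where I = I] by blast
  \<comment> \<open>The sorted letters of the block are to be read in the order \<open>bs\<close>,
    \<open>q\<close>, \<open>as\<close>: the first \<open>length bs\<close> of them go after
    \<open>q\<close>, the next one, \<open>m\<close>, to \<open>q\<close> itself, and the rest
    before \<open>q\<close>. Then \<open>m\<close> determines the keys for the other blocks.\<close>
  define S where "S = sort (map z (blist N I (blk I q)))"
  have lenS: "length S = length as + 1 + length bs" by (simp add: S_def s)
  define B where "B = take (length bs) S"
  define m where "m = S ! length bs"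
  define A where "A = drop (Suc (length bs)) S"
  have S: "S = B @ m # A"
    unfolding A_def B_def m_def using lenS by (intro id_take_nth_drop) simp
  have lenA: "length A = length as" and lenB: "length B = length bs"
    using lenS by (auto simp: A_def B_def)
  define l where "l k = (if k < blk I q then sort_key (keyL m) (map z (blist N I k))
     else if k = blk I q then A @ m # B else sort_key (keyR m) (map z (blist N I k)))" for k
  have ml: "mset (l k) = mset (map z (blist N I k))" for k
  proof -
    have "mset (A @ m # B) = mset S" by (simp add: S)
    also have "\<dots> = mset (map z (blist N I (blk I q)))" by (simp only: S_def mset_sort)
    finally show ?thesis by (simp add: l_def)
  qed
  then obtain z' where z': "\<And>k. map z' (blist N I k) = l k"
    using place_blocks[of l z N I] by blast
  have "map z' as @ z' q # map z' bs = A @ m # B"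
    using z'[of "blk I q"] by (simp add: s l_def)
  then have e: "map z' as = A" "z' q = m" "map z' bs = B" using lenA by auto
  have "sorted (map (rkey q z') (blist N I k))" for k
  proof -
    consider "k < blk I q" | "k = blk I q" | "blk I q < k" by linarith
    then show ?thesis
    proof cases
      case 1 then show ?thesis
        by (simp only: map_rkey_side z' e) (simp add: l_def)
    next
      case 2
      have "sorted (map z' bs @ z' q # map z' as)" unfolding e S[symmetric] by (simp add: S_def)
      then show ?thesis using sorted_rkey_middle[OF s] 2 by blast
    next
      case 3 then show ?thesis
        by (simp only: map_rkey_side z' e) (simp add: l_def)
    qed
  qed
  then show ?thesis using z' ml by metis
qed

lemma block_sorted_exists:
  fixes z :: "nat \<Rightarrow> nat"
  shows "\<exists>z'. (\<forall>k. sorted (map z' (blist N I k))) \<and>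
     (\<forall>k. mset (map z' (blist N I k)) = mset (map z (blist N I k)))"
proof -
  obtain z' where z': "\<And>k. map z' (blist N I k) = sort (map z (blist N I k))"
    using place_blocks[of "\<lambda>k. sort (map z (blist N I k))" z N I] by auto
  show ?thesis by (intro exI[of _ z']) (simp only: z' sorted_sort mset_sort simp_thms)
qed

section \<open>Standardization of the word of blocks\<close>

lemma mset_map_permutes:
  assumes "\<tau> permutes {1..N}"
  shows "mset (map (\<lambda>i. f (\<tau> i)) [1..<Suc N]) = mset (map f [1..<Suc N])"
proof -
  have "image_mset \<tau> (mset_set {1..N}) = mset_set {1..N}"
    using permutes_inj_on[OF assms] permutes_image[OF assms] by (simp add: image_mset_mset_set)
  then have "image_mset f (image_mset \<tau> (mset_set {1..N})) = image_mset f (mset_set {1..N})"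
    by simp
  moreover have "mset [1..<Suc N] = mset_set {1..N}"
    by (metis mset_upt atLeastLessThanSuc_atLeastAtMost)
  ultimately show ?thesis by (simp add: multiset.map_comp comp_def del: upt_Suc)
qed

text \<open>The inverse of \<open>\<sigma>\<close> has all its descents in \<open>J\<close> iff \<open>\<sigma>\<close> is the standardization of the word of
  its \<open>J\<close>-blocks.\<close>

definition invdes :: "nat \<Rightarrow> nat set \<Rightarrow> (nat \<Rightarrow> nat) set" where
  "invdes N J = {\<sigma>. \<sigma> permutes {1..N} \<and> Des N (inv \<sigma>) \<subseteq> J}"

lemma Des_subset_iff:
  "Des N w \<subseteq> I \<longleftrightarrow> (\<forall>k. sorted (map w (blist N I k)))"
  unfolding weak_ascents_iff_sorted_blocks[symmetric] by (force simp: Des_def not_less)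

text \<open>Block numbers grow weakly with the values, and within one block of values
  \<open>inv \<sigma>\<close> has no descent, so equal letters are ranked by position.\<close>

lemma invdes_less_iff:
  assumes "\<sigma> \<in> invdes N J" "a \<in> {1..N}" "b \<in> {1..N}"
  shows "\<sigma> a < \<sigma> b \<longleftrightarrow> (blk J (\<sigma> a), a) < (blk J (\<sigma> b), b)"
proof -
  have p: "\<sigma> permutes {1..N}" and d: "\<And>k. sorted (map (inv \<sigma>) (blist N J k))"
    using assms(1) by (auto simp: invdes_def Des_subset_iff)
  have *: "(blk J (\<sigma> a), a) < (blk J (\<sigma> b), b)" if "\<sigma> a < \<sigma> b" "a \<in> {1..N}" "b \<in> {1..N}" for a b
  proof -
    have r: "\<sigma> a \<in> {1..N}" "\<sigma> b \<in> {1..N}" using permutes_in_image[OF p] that by auto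
    have "a \<noteq> b" using that by auto
    moreover have "blk J (\<sigma> a) \<le> blk J (\<sigma> b)" using that by (intro blk_mono) simp
    moreover have "a \<le> b" if "blk J (\<sigma> a) = blk J (\<sigma> b)"
      using sorted_blist_D[OF d, of "\<sigma> a" "\<sigma> b"] r that \<open>\<sigma> a < \<sigma> b\<close> permutes_inverses[OF p] by auto
    ultimately show ?thesis by fastforce
  qed
  have "a = b" if "\<sigma> a = \<sigma> b" using permutes_inj[OF p] that by (auto dest: injD)
  then show ?thesis using *[of a b] *[of b a] assms
    by (metis less_asym linorder_neqE_nat less_irrefl)
qed

text \<open>The composite \<open>\<tau> \<circ> inv \<sigma>\<close> is strictly increasing on
  \<open>{1..N}\<close> and maps it onto itself, so it is the identity there.\<close>

lemma permutes_order_unique: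
  fixes \<sigma> \<tau> :: "nat \<Rightarrow> nat"
  assumes "\<sigma> permutes {1..N}" "\<tau> permutes {1..N}"
    and ord: "\<And>a b. a \<in> {1..N} \<Longrightarrow> b \<in> {1..N} \<Longrightarrow> \<sigma> a < \<sigma> b \<longleftrightarrow> \<tau> a < \<tau> b"
  shows "\<sigma> = \<tau>"
proof -
  let ?xs = "[1..<Suc N]"
  have i: "inv \<sigma> permutes {1..N}" by (rule permutes_inv[OF assms(1)])
  have c: "(\<tau> \<circ> inv \<sigma>) permutes {1..N}" by (rule permutes_compose[OF i assms(2)])
  have set: "set ?xs = {1..N}" by auto
  have "sorted_wrt (<) (map (\<tau> \<circ> inv \<sigma>) ?xs)"
    unfolding sorted_wrt_map
  proof (rule sorted_wrt_mono_rel[of _ "(<)"])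
    fix v w assume *: "v \<in> set ?xs" "w \<in> set ?xs" "v < w"
    then show "(\<tau> \<circ> inv \<sigma>) v < (\<tau> \<circ> inv \<sigma>) w"
      using ord[of "inv \<sigma> v" "inv \<sigma> w"] permutes_in_image[OF i] permutes_inverses[OF assms(1)]
      unfolding set by auto
  qed (rule sorted_wrt_upt)
  moreover have "set ?xs = set (map (\<tau> \<circ> inv \<sigma>) ?xs)"
    unfolding set_map set using permutes_image[OF c] by simp
  ultimately have "map (\<tau> \<circ> inv \<sigma>) ?xs = ?xs"
    using strict_sorted_equal sorted_wrt_upt by blast
  then have "\<And>v. v \<in> {1..N} \<Longrightarrow> (\<tau> \<circ> inv \<sigma>) v = v"
    unfolding set[symmetric] by (metis map_eq_conv map_ident)
  then have "\<tau> (inv \<sigma> (\<sigma> a)) = \<sigma> a" if "a \<in> {1..N}" for a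
    using that permutes_in_image[OF assms(1)] by (metis comp_apply)
  then show ?thesis
    using permutes_inverses[OF assms(1)] permutes_not_in[OF assms(1)] permutes_not_in[OF assms(2)]
    by (metis ext)
qed

lemma invdes_unique:
  assumes "\<sigma> \<in> invdes N J" "\<tau> \<in> invdes N J"
    and "\<And>i. i \<in> {1..N} \<Longrightarrow> blk J (\<sigma> i) = blk J (\<tau> i)"
  shows "\<sigma> = \<tau>"
  using assms by (intro permutes_order_unique[of _ N]) (auto simp: invdes_less_iff simp: invdes_def)

lemma rank_permutes:
  fixes key :: "nat \<Rightarrow> 'b::linorder"
  assumes "inj_on key {1..N}"
  shows "\<exists>\<sigma>. \<sigma> permutes {1..N} \<and> (\<forall>a\<in>{1..N}. \<forall>b\<in>{1..N}. \<sigma> a < \<sigma> b \<longleftrightarrow> key a < key b)"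
proof -
  define \<sigma> where "\<sigma> a = (if a \<in> {1..N} then card {b \<in> {1..N}. key b \<le> key a} else a)" for a
  have less: "\<sigma> a < \<sigma> b" if "a \<in> {1..N}" "b \<in> {1..N}" "key a < key b" for a b
  proof -
    have "{c \<in> {1..N}. key c \<le> key a} \<subset> {c \<in> {1..N}. key c \<le> key b}"
      using that by (auto simp: psubset_eq set_eq_iff) (metis not_less order_refl)
    then have "card {c \<in> {1..N}. key c \<le> key a} < card {c \<in> {1..N}. key c \<le> key b}"
      by (intro psubset_card_mono) auto
    then show ?thesis using that by (simp add: \<sigma>_def)
  qed
  have iff: "\<sigma> a < \<sigma> b \<longleftrightarrow> key a < key b" if "a \<in> {1..N}" "b \<in> {1..N}" for a b
    using less[of a b] less[of b a] that assms
    by (metis inj_onD less_asym less_irrefl linorder_less_linear)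
  have inj: "inj_on \<sigma> {1..N}"
    using iff assms by (intro inj_onI) (metis inj_onD less_irrefl linorder_less_linear)
  have "\<sigma> ` {1..N} \<subseteq> {1..N}"
  proof safe
    fix a assume a: "a \<in> {1..N}"
    have "card {b \<in> {1..N}. key b \<le> key a} \<le> card {1..N}" by (rule card_mono) auto
    moreover have "0 < card {b \<in> {1..N}. key b \<le> key a}" using a by (subst card_gt_0_iff) auto
    ultimately show "\<sigma> a \<in> {1..N}" using a by (simp add: \<sigma>_def)
  qed
  then have "bij_betw \<sigma> {1..N} {1..N}"
    using inj by (simp add: bij_betw_def endo_inj_surj)
  then have "\<sigma> permutes {1..N}"
    by (rule bij_imp_permutes) (auto simp: \<sigma>_def)
  then show ?thesis using iff by blast
qed

text \<open>Ranking the pairs \<open>(u i, i)\<close> standardizes \<open>u\<close>; the prescribed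
  content makes the values given to each letter fill exactly the \<open>J\<close>-block of that
  number.\<close>

lemma invdes_exists:
  assumes "mset (map u [1..<Suc N]) = mset (map (blk J) [1..<Suc N])"
  shows "\<exists>\<sigma>\<in>invdes N J. \<forall>i\<in>{1..N}. blk J (\<sigma> i) = u i"
proof -
  have "inj_on (\<lambda>i. (u i, i)) {1..N}" by (auto simp: inj_on_def)
  from rank_permutes[OF this] obtain \<sigma> where p: "\<sigma> permutes {1..N}"
    and ord: "\<And>a b. a \<in> {1..N} \<Longrightarrow> b \<in> {1..N} \<Longrightarrow> \<sigma> a < \<sigma> b \<longleftrightarrow> (u a, a) < (u b, b)" by blast
  let ?xs = "[1..<Suc N]"
  have i: "inv \<sigma> permutes {1..N}" by (rule permutes_inv[OF p])
  have set: "set ?xs = {1..N}" by auto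
  have lt: "(u (inv \<sigma> v), inv \<sigma> v) < (u (inv \<sigma> w), inv \<sigma> w)"
    if "v \<in> {1..N}" "w \<in> {1..N}" "v < w" for v w
    using that ord[of "inv \<sigma> v" "inv \<sigma> w"] permutes_in_image[OF i] permutes_inverses[OF p] by auto
  \<comment> \<open>Read in order of increasing value, the letters of \<open>u\<close> form a sorted
    word, and its content determines it.\<close>
  have "map (\<lambda>v. u (inv \<sigma> v)) ?xs = map (blk J) ?xs"
  proof (rule sorted_mset_unique)
    show "sorted (map (\<lambda>v. u (inv \<sigma> v)) ?xs)"
      unfolding sorted_wrt_map
    proof (rule sorted_wrt_mono_rel[of _ "(<)"])
      fix v w assume *: "v \<in> set ?xs" "w \<in> set ?xs" "v < w"
      then show "u (inv \<sigma> v) \<le> u (inv \<sigma> w)" using lt[of v w] unfolding set by auto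
    qed (rule sorted_wrt_upt)
    show "sorted (map (blk J) ?xs)"
      unfolding sorted_wrt_map
      by (rule sorted_wrt_mono_rel[OF _ sorted_wrt_upt]) (auto intro: blk_mono)
    show "mset (map (\<lambda>v. u (inv \<sigma> v)) ?xs) = mset (map (blk J) ?xs)"
      using mset_map_permutes[OF i, of u] assms by simp
  qed
  then have uv: "u (inv \<sigma> v) = blk J v" if "v \<in> {1..N}" for v
    using that unfolding set[symmetric] by (metis map_eq_conv)
  have b: "blk J (\<sigma> a) = u a" if "a \<in> {1..N}" for a
    using uv[of "\<sigma> a"] that permutes_in_image[OF p] permutes_inverses[OF p] by auto
  \<comment> \<open>Values in one block carry equal letters, and these were ranked by
    position.\<close>
  have "sorted (map (inv \<sigma>) (blist N J k))" for k
    unfolding sorted_wrt_map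
  proof (rule sorted_wrt_mono_rel[OF _ blist_strict])
    fix v w assume "v \<in> set (blist N J k)" "w \<in> set (blist N J k)" "v < w"
    then show "inv \<sigma> v \<le> inv \<sigma> w" using lt[of v w] uv[of v] uv[of w] by (auto simp: set_blist)
  qed
  then have "\<sigma> \<in> invdes N J" using p by (simp add: invdes_def Des_subset_iff)
  then show ?thesis using b by blast
qed

section \<open>Powers of the long cycle and the recut permutation\<close>

lemma cyc_pow:
  assumes "1 \<le> i" "i \<le> n" "k \<le> n"
  shows "(cyc n ^^ k) i = (if i + k \<le> n then i + k else i + k - n)"
  using assms(3)
proof (induction k)
  case (Suc k)
  then have "(cyc n ^^ Suc k) i = cyc n (if i + k \<le> n then i + k else i + k - n)" by simp
  also have "\<dots> = (if i + Suc k \<le> n then i + Suc k else i + Suc k - n)"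
    using assms(1,2) Suc.prems by (auto simp: cyc_def)
  finally show ?case .
qed (use assms in auto)

lemma cyc_permutes:
  assumes "1 \<le> n"
  shows "cyc n permutes {1..n}"
proof (rule bij_imp_permutes)
  have "inj_on (cyc n) {1..n}" by (auto simp: inj_on_def cyc_def split: if_splits)
  moreover have "cyc n ` {1..n} \<subseteq> {1..n}" by (auto simp: cyc_def)
  ultimately show "bij_betw (cyc n) {1..n} {1..n}" by (simp add: bij_betw_def endo_inj_surj)
qed (use assms in \<open>auto simp: cyc_def\<close>)

lemma cyc_pow_permutes: "1 \<le> n \<Longrightarrow> (cyc n ^^ k) permutes {1..n}"
proof (induction k)
  case 0
  then show ?case by (simp add: permutes_id[unfolded id_def])
next
  case (Suc k)
  then show ?case using permutes_compose[OF Suc.IH cyc_permutes] unfolding funpow.simps by blast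
qed

lemma cyc_pow_self:
  assumes "1 \<le> n"
  shows "cyc n ^^ n = id"
proof
  fix i
  show "(cyc n ^^ n) i = id i"
    using cyc_pow[of i n n] permutes_not_in[OF cyc_pow_permutes[OF assms, of n], of i]
    by (cases "i \<in> {1..n}") auto
qed

definition recut :: "nat \<Rightarrow> nat \<Rightarrow> (nat \<Rightarrow> nat) \<Rightarrow> nat \<Rightarrow> nat" where
  "recut n p \<sigma> = (cyc n ^^ (n - \<sigma> p)) \<circ> \<sigma> \<circ> (cyc n ^^ p)"

text \<open>On \<open>{1..n-1}\<close> the power \<open>cyc n ^^ p\<close> reaches \<open>n\<close>
  from \<open>n - p\<close> and misses \<open>p\<close>. Sending \<open>n - p\<close> to
  \<open>p\<close> instead repairs this, so that the rotated word keeps the letter of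
  \<open>p\<close> in the place where \<open>n\<close> would stand.\<close>

definition slide :: "nat \<Rightarrow> nat \<Rightarrow> nat \<Rightarrow> nat" where
  "slide n p i = (if 1 \<le> i \<and> i < n then
     if i + p < n then i + p else if i + p = n then p else i + p - n else i)"

lemma permutes_Suc: "\<sigma> permutes {1..N} \<Longrightarrow> \<sigma> permutes {1..Suc N}"
  by (rule permutes_subset) auto

text \<open>The three factors carry \<open>Suc N\<close> to \<open>p\<close>, then to
  \<open>\<sigma> p\<close>, then back to \<open>Suc N\<close>.\<close>

lemma recut_permutes:
  assumes "\<sigma> permutes {1..N}" "p \<in> {1..Suc N}"
  shows "recut (Suc N) p \<sigma> permutes {1..N}"
proof (rule permutes_superset)
  have s: "\<sigma> permutes {1..Suc N}" by (rule permutes_Suc[OF assms(1)])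
  show "recut (Suc N) p \<sigma> permutes {1..Suc N}"
    unfolding recut_def by (intro permutes_compose cyc_pow_permutes s) auto
  fix i assume "i \<in> {1..Suc N} - {1..N}"
  then have i: "i = Suc N" by auto
  have "\<sigma> p \<in> {1..Suc N}" using permutes_in_image[OF s] assms(2) by simp
  then show "recut (Suc N) p \<sigma> i = i"
    using assms(2) by (simp add: i recut_def cyc_pow)
qed

lemma slide_permutes:
  assumes "p \<in> {1..N}"
  shows "slide (Suc N) p permutes {1..N}"
proof (rule bij_imp_permutes)
  have "inj_on (slide (Suc N) p) {1..N}"
    using assms by (auto simp: inj_on_def slide_def split: if_splits)
  moreover have "slide (Suc N) p ` {1..N} \<subseteq> {1..N}"
    using assms by (auto simp: slide_def)
  ultimately show "bij_betw (slide (Suc N) p) {1..N} {1..N}"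
    by (simp add: bij_betw_def endo_inj_surj)
qed (auto simp: slide_def)

text \<open>With \<open>v = \<sigma> p\<close>, the left rotation moves the values above
  \<open>v\<close> below the image of \<open>Suc N\<close> and those up to \<open>v\<close> above
  it, preserving the order within either group. These are the three first components of
  \<open>rkey\<close>, and since \<open>\<sigma>\<close> is a standardization, comparison with
  \<open>v\<close> can be read off from letters and positions.\<close>

lemma recut_le_iff:
  assumes s: "\<sigma> \<in> invdes N J" and p: "p \<in> {1..N}" and i: "i \<in> {1..N-1}"
    and z: "z = (\<lambda>i. blk J (\<sigma> (slide (Suc N) p i)))"
  shows "recut (Suc N) p \<sigma> i \<le> recut (Suc N) p \<sigma> (i + 1) \<longleftrightarrow>
     rkey (Suc N - p) z i \<le> rkey (Suc N - p) z (i + 1)"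
proof -
  let ?n = "Suc N" and ?v = "\<sigma> p"
  define q where "q = ?n - p"
  have sp: "\<sigma> permutes {1..N}" using s by (simp add: invdes_def)
  have rng: "1 \<le> \<sigma> a \<and> \<sigma> a \<le> N" if "1 \<le> a" "a \<le> N" for a
    using permutes_in_image[OF sp, of a] that by auto
  have sn: "\<sigma> ?n = ?n" using permutes_not_in[OF sp] by simp
  have v: "1 \<le> ?v" "?v \<le> N" using rng p by auto
  have lt: "\<sigma> a < \<sigma> b \<longleftrightarrow> blk J (\<sigma> a) < blk J (\<sigma> b) \<or> blk J (\<sigma> a) = blk J (\<sigma> b) \<and> a < b"
    if "1 \<le> a" "a \<le> N" "1 \<le> b" "b \<le> N" for a b
    using invdes_less_iff[OF s, of a b] that by auto
  have C: "(cyc ?n ^^ (?n - ?v)) b = (if b \<le> ?v then b + ?n - ?v else b - ?v)"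
    if "1 \<le> b" "b \<le> ?n" for b using that v by (subst cyc_pow) auto
  have rL: "recut ?n p \<sigma> j = (if \<sigma> (j + p) \<le> ?v then \<sigma> (j + p) + ?n - ?v else \<sigma> (j + p) - ?v)"
    if "1 \<le> j" "j < q" for j
  proof -
    have "(cyc ?n ^^ p) j = j + p" using that p by (subst cyc_pow) (auto simp: q_def)
    moreover have "j + p \<le> N" using that by (simp add: q_def)
    ultimately show ?thesis using p rng[of "j + p"] by (simp add: recut_def C)
  qed
  have rq: "recut ?n p \<sigma> q = ?n - ?v"
  proof -
    have "(cyc ?n ^^ p) q = ?n" using p by (subst cyc_pow) (auto simp: q_def)
    then show ?thesis using v C[of ?n] by (simp add: recut_def sn)
  qed
  have rR: "recut ?n p \<sigma> j = (if \<sigma> (j - q) \<le> ?v then \<sigma> (j - q) + ?n - ?v else \<sigma> (j - q) - ?v)"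
    if "q < j" "j \<le> N" for j
  proof -
    have "(cyc ?n ^^ p) j = j - q" using that p by (subst cyc_pow) (auto simp: q_def)
    moreover have "1 \<le> j - q" "j - q \<le> N" using that by auto
    ultimately show ?thesis using rng[of "j - q"] by (simp add: recut_def C)
  qed
  have zL: "z j = blk J (\<sigma> (j + p))" if "1 \<le> j" "j < q" for j
    using that p by (auto simp: z slide_def q_def)
  have zq: "z q = blk J ?v" using p by (auto simp: z slide_def q_def)
  have zR: "z j = blk J (\<sigma> (j - q))" if "q < j" "j \<le> N" for j
  proof -
    have "slide ?n p j = j - q" using that p by (auto simp: slide_def q_def)
    then show ?thesis by (simp add: z)
  qed
  have gL: "\<sigma> (j + p) \<le> ?v \<longleftrightarrow> \<not> z q \<le> z j" if "1 \<le> j" "j < q" for j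
    using lt[of p "j + p"] that p zL[OF that] zq by (auto simp: q_def not_less[symmetric])
  have gR: "\<sigma> (j - q) \<le> ?v \<longleftrightarrow> z j \<le> z q" if "q < j" "j \<le> N" for j
  proof -
    have "1 \<le> j - q" "j - q \<le> N" "j - q < p" using that p by (auto simp: q_def)
    then show ?thesis
      using lt[of p "j - q"] p zR[OF that] zq by (auto simp: not_less[symmetric] simp del: diff_is_0_eq)
  qed
  have i': "1 \<le> i" "i + 1 \<le> N" using i by auto
  consider "i + 1 < q" | "i + 1 = q" | "i = q" | "q < i" by linarith
  then have "recut ?n p \<sigma> i \<le> recut ?n p \<sigma> (i + 1) \<longleftrightarrow> rkey q z i \<le> rkey q z (i + 1)"
  proof cases
    case 1
    have le: "\<sigma> (i + p) \<le> \<sigma> (i + 1 + p) \<longleftrightarrow> z i \<le> z (i + 1)"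
      using lt[of "i + 1 + p" "i + p"] zL[of i] zL[of "i + 1"] 1 i' p
      by (auto simp: q_def not_less[symmetric])
    have b: "1 \<le> \<sigma> (i + p)" "\<sigma> (i + p) \<le> N" "1 \<le> \<sigma> (i + 1 + p)" "\<sigma> (i + 1 + p) \<le> N"
      using rng[of "i + p"] rng[of "i + 1 + p"] 1 p by (auto simp: q_def)
    show ?thesis
      using 1 i' rL[of i] rL[of "i + 1"] gL[of i] gL[of "i + 1"] le b v
      by (auto simp: rkey_def keyL_def)
  next
    case 2
    have b: "1 \<le> \<sigma> (i + p)" "\<sigma> (i + p) \<le> N"
      using rng[of "i + p"] 2 i' p by (auto simp: q_def)
    show ?thesis
      using 2 i' rL[of i] rq gL[of i] b v by (auto simp: rkey_def keyL_def)
  next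
    case 3
    have b: "1 \<le> \<sigma> (i + 1 - q)" "\<sigma> (i + 1 - q) \<le> N"
      using rng[of "i + 1 - q"] 3 i' p by (auto simp: q_def)
    show ?thesis
      using 3 i' rR[of "i + 1"] rq gR[of "i + 1"] b v by (auto simp: rkey_def keyR_def)
  next
    case 4
    have le: "\<sigma> (i - q) \<le> \<sigma> (i + 1 - q) \<longleftrightarrow> z i \<le> z (i + 1)"
    proof -
      have "1 \<le> i - q" "i - q < i + 1 - q" "i + 1 - q \<le> N" using 4 i' by auto
      then show ?thesis
        using lt[of "i + 1 - q" "i - q"] zR[of i] zR[of "i + 1"] 4 i' by (simp add: not_less[symmetric])
    qed
    have b: "1 \<le> \<sigma> (i - q)" "\<sigma> (i - q) \<le> N" "1 \<le> \<sigma> (i + 1 - q)" "\<sigma> (i + 1 - q) \<le> N"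
      using rng[of "i - q"] rng[of "i + 1 - q"] 4 i' p by (auto simp: q_def)
    define \<alpha> \<beta> where "\<alpha> = \<sigma> (i - q)" and "\<beta> = \<sigma> (i + 1 - q)"
    note ab = \<alpha>_def[symmetric] \<beta>_def[symmetric]
    have "recut ?n p \<sigma> i = (if \<alpha> \<le> ?v then \<alpha> + ?n - ?v else \<alpha> - ?v)"
      "recut ?n p \<sigma> (i + 1) = (if \<beta> \<le> ?v then \<beta> + ?n - ?v else \<beta> - ?v)"
      using 4 i' rR[of i] rR[of "i + 1"] unfolding ab by auto
    moreover have "\<alpha> \<le> ?v \<longleftrightarrow> z i \<le> z q" "\<beta> \<le> ?v \<longleftrightarrow> z (i + 1) \<le> z q"
      using 4 i' gR[of i] gR[of "i + 1"] unfolding ab by auto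
    ultimately show ?thesis
      using 4 le b v unfolding ab by (auto simp: rkey_def keyR_def)
  qed
  then show ?thesis by (simp add: q_def)
qed

lemma Des_recut_subset_iff:
  assumes "\<sigma> \<in> invdes N J" "p \<in> {1..N}"
  shows "Des N (recut (Suc N) p \<sigma>) \<subseteq> I \<longleftrightarrow>
    (\<forall>k. sorted (map (rkey (Suc N - p) (\<lambda>i. blk J (\<sigma> (slide (Suc N) p i)))) (blist N I k)))"
proof -
  have "Des N (recut (Suc N) p \<sigma>) \<subseteq> I \<longleftrightarrow>
     (\<forall>i\<in>{1..N-1}. i \<notin> I \<longrightarrow> recut (Suc N) p \<sigma> i \<le> recut (Suc N) p \<sigma> (i + 1))"
    by (force simp: Des_def not_less)
  also have "\<dots> \<longleftrightarrow> (\<forall>k. sorted (map (rkey (Suc N - p) (\<lambda>i. blk J (\<sigma> (slide (Suc N) p i)))) (blist N I k)))"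
    unfolding weak_ascents_iff_sorted_blocks[symmetric]
    using recut_le_iff[OF assms _ refl] by blast
  finally show ?thesis .
qed

text \<open>Equal letters of a standardization increase from left to right, so the ascents of
  \<open>\<sigma>\<close> are the weak ascents of its word.\<close>

lemma Des_subset_iff_blk:
  assumes "\<sigma> \<in> invdes N J"
  shows "Des N \<sigma> \<subseteq> I \<longleftrightarrow> (\<forall>k. sorted (map (\<lambda>i. blk J (\<sigma> i)) (blist N I k)))"
proof -
  have "Des N \<sigma> \<subseteq> I \<longleftrightarrow> (\<forall>i\<in>{1..N-1}. i \<notin> I \<longrightarrow> \<sigma> i \<le> \<sigma> (i + 1))"
    by (force simp: Des_def not_less)
  also have "\<dots> \<longleftrightarrow> (\<forall>i\<in>{1..N-1}. i \<notin> I \<longrightarrow> blk J (\<sigma> i) \<le> blk J (\<sigma> (i + 1)))"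
  proof -
    have "\<sigma> i \<le> \<sigma> (i + 1) \<longleftrightarrow> blk J (\<sigma> i) \<le> blk J (\<sigma> (i + 1))" if "i \<in> {1..N-1}" for i
      using invdes_less_iff[OF assms, of "i + 1" i] that by (auto simp: not_less[symmetric])
    then show ?thesis by blast
  qed
  finally show ?thesis
    using weak_ascents_iff_sorted_blocks[of N I "\<lambda>i. blk J (\<sigma> i)"] by blast
qed

section \<open>Counting by the letters in each block\<close>

text \<open>The condition fixes the total content: each letter occurs as often as its
  \<open>J\<close>-block has values, which is what standardization requires.\<close>

definition profiles :: "nat \<Rightarrow> nat set \<Rightarrow> nat set \<Rightarrow> (nat \<Rightarrow> nat multiset) set" where
  "profiles N I J = {(\<lambda>k. mset (map z (blist N I k))) | z.
     mset (map z [1..<Suc N]) = mset (map (blk J) [1..<Suc N])}"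

text \<open>Both statistics are handled at once: \<open>\<rho>\<close> rearranges the positions of the word of blocks of
  \<open>\<sigma>\<close> and \<open>Q\<close> singles out one representative word of each profile.\<close>

lemma card_invdes_eq_card_profiles:
  assumes rho: "\<rho> permutes {1..N}"
    and iff: "\<And>\<sigma>. \<sigma> \<in> invdes N J \<Longrightarrow> P \<sigma> \<longleftrightarrow> Q (\<lambda>i. blk J (\<sigma> (\<rho> i)))"
    and cong: "\<And>z z'. (\<And>i. i \<in> {1..N} \<Longrightarrow> z i = z' i) \<Longrightarrow> Q z \<Longrightarrow> Q z'"
    and ex: "\<And>z. \<exists>z'. Q z' \<and> (\<forall>k. mset (map z' (blist N I k)) = mset (map z (blist N I k)))"
    and uniq: "\<And>z z' i. Q z \<Longrightarrow> Q z' \<Longrightarrow>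
      (\<And>k. mset (map z (blist N I k)) = mset (map z' (blist N I k))) \<Longrightarrow> i \<in> {1..N} \<Longrightarrow> z i = z' i"
  shows "card {\<sigma> \<in> invdes N J. P \<sigma>} = card (profiles N I J)"
proof -
  let ?X = "{\<sigma> \<in> invdes N J. P \<sigma>}"
  define F where "F \<sigma> = (\<lambda>k. mset (map (\<lambda>i. blk J (\<sigma> (\<rho> i))) (blist N I k)))" for \<sigma>
  have irho: "inv \<rho> permutes {1..N}" by (rule permutes_inv[OF rho])
  have "inj_on F ?X"
  proof (rule inj_onI)
    fix \<sigma> \<tau> assume st: "\<sigma> \<in> ?X" "\<tau> \<in> ?X" and "F \<sigma> = F \<tau>"
    then have M: "mset (map (\<lambda>i. blk J (\<sigma> (\<rho> i))) (blist N I k)) = mset (map (\<lambda>i. blk J (\<tau> (\<rho> i))) (blist N I k))" for k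
      unfolding F_def by meson
    have e: "blk J (\<sigma> (\<rho> i)) = blk J (\<tau> (\<rho> i))" if "i \<in> {1..N}" for i
      using st iff by (intro uniq[OF _ _ M that]) auto
    have "blk J (\<sigma> i) = blk J (\<tau> i)" if "i \<in> {1..N}" for i
      using e[of "inv \<rho> i"] that permutes_in_image[OF irho] permutes_inverses[OF rho] by auto
    then show "\<sigma> = \<tau>" using st by (intro invdes_unique[of _ N J]) auto
  qed
  moreover have "F ` ?X = profiles N I J"
  proof (intro equalityI subsetI)
    fix f assume "f \<in> F ` ?X"
    then obtain \<sigma> where s: "\<sigma> \<in> invdes N J" "f = F \<sigma>" by auto
    have "mset (map (\<lambda>i. blk J (\<sigma> (\<rho> i))) [1..<Suc N]) = mset (map (blk J) [1..<Suc N])"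
      using mset_map_permutes[OF rho, of "\<lambda>i. blk J (\<sigma> i)"] mset_map_permutes[of \<sigma> N "blk J"] s(1)
      by (simp add: invdes_def del: upt_Suc mset_map)
    then show "f \<in> profiles N I J" using s(2) unfolding F_def profiles_def by blast
  next
    fix f assume "f \<in> profiles N I J"
    then obtain z where f: "f = (\<lambda>k. mset (map z (blist N I k)))"
      and c: "mset (map z [1..<Suc N]) = mset (map (blk J) [1..<Suc N])"
      unfolding profiles_def by blast
    obtain z' where Q: "Q z'" and M: "\<And>k. mset (map z' (blist N I k)) = mset (map z (blist N I k))"
      using ex by blast
    \<comment> \<open>The representative \<open>z'\<close> is indexed by rearranged positions;
      undoing the rearrangement gives the word to be standardized.\<close>
    have "mset (map (\<lambda>i. z' (inv \<rho> i)) [1..<Suc N]) = mset (map (blk J) [1..<Suc N])"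
      using mset_map_permutes[OF irho, of z'] mset_map_cong_blocks[OF M] c by simp
    from invdes_exists[OF this] obtain \<sigma> where s: "\<sigma> \<in> invdes N J"
      and b: "\<And>i. i \<in> {1..N} \<Longrightarrow> blk J (\<sigma> i) = z' (inv \<rho> i)" by blast
    have e: "blk J (\<sigma> (\<rho> i)) = z' i" if "i \<in> {1..N}" for i
      using b[of "\<rho> i"] that permutes_in_image[OF rho] permutes_inverses[OF rho] by auto
    have "P \<sigma>" unfolding iff[OF s] by (rule cong[OF _ Q]) (simp add: e)
    moreover have "f = F \<sigma>"
    proof
      fix k
      have "map (\<lambda>i. blk J (\<sigma> (\<rho> i))) (blist N I k) = map z' (blist N I k)"
        using e by (simp add: set_blist)
      then show "f k = F \<sigma> k" unfolding f F_def by (simp only: M)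
    qed
    ultimately show "f \<in> F ` ?X" using s by blast
  qed
  ultimately show ?thesis by (metis card_image)
qed

text \<open>Each profile contains exactly one word that is sorted for \<open>rkey\<close> and
  exactly one that is sorted in the usual order on every block, so both sides count
  profiles.\<close>

lemma card_invdes_Des_recut:
  assumes p: "p \<in> {1..N}"
  shows "card {\<sigma> \<in> invdes N J. Des N (recut (Suc N) p \<sigma>) \<subseteq> I} = card {\<sigma> \<in> invdes N J. Des N \<sigma> \<subseteq> I}"
proof -
  let ?q = "Suc N - p"
  have q: "1 \<le> ?q" "?q \<le> N" using p by auto
  have "card {\<sigma> \<in> invdes N J. Des N (recut (Suc N) p \<sigma>) \<subseteq> I} = card (profiles N I J)"
  proof (rule card_invdes_eq_card_profiles[OF slide_permutes[OF p],
        where Q = "\<lambda>z. \<forall>k. sorted (map (rkey ?q z) (blist N I k))"])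
    fix z z' :: "nat \<Rightarrow> nat"
    assume e: "\<And>i. i \<in> {1..N} \<Longrightarrow> z i = z' i" and z: "\<forall>k. sorted (map (rkey ?q z) (blist N I k))"
    \<comment> \<open>Every value of \<open>rkey\<close> except the one at \<open>?q\<close> also
      consults the letter at \<open>?q\<close>, which lies in the range of agreement.\<close>
    have "z ?q = z' ?q" using e q by auto
    then have "map (rkey ?q z) (blist N I k) = map (rkey ?q z') (blist N I k)" for k
      using e by (auto simp: set_blist rkey_def)
    then show "\<forall>k. sorted (map (rkey ?q z') (blist N I k))" using z by metis
  next
    fix z z' :: "nat \<Rightarrow> nat" and i
    assume "\<forall>k. sorted (map (rkey ?q z) (blist N I k))" "\<forall>k. sorted (map (rkey ?q z') (blist N I k))"
      "\<And>k. mset (map z (blist N I k)) = mset (map z' (blist N I k))" "i \<in> {1..N}"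
    then show "z i = z' i" using rkey_sorted_unique[OF q, of z I z' i] by blast
  qed (use p in \<open>simp_all add: Des_recut_subset_iff rkey_sorted_exists[OF q] del: mset_map\<close>)
  moreover have "card {\<sigma> \<in> invdes N J. Des N \<sigma> \<subseteq> I} = card (profiles N I J)"
  proof (rule card_invdes_eq_card_profiles[OF permutes_id,
        where Q = "\<lambda>z. \<forall>k. sorted (map z (blist N I k))"])
    fix z z' :: "nat \<Rightarrow> nat"
    assume e: "\<And>i. i \<in> {1..N} \<Longrightarrow> z i = z' i" and z: "\<forall>k. sorted (map z (blist N I k))"
    have "map z (blist N I k) = map z' (blist N I k)" for k using e by (auto simp: set_blist)
    then show "\<forall>k. sorted (map z' (blist N I k))" using z by metis
  next
    fix z z' :: "nat \<Rightarrow> nat" and i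
    assume "\<forall>k. sorted (map z (blist N I k))" "\<forall>k. sorted (map z' (blist N I k))"
      "\<And>k. mset (map z (blist N I k)) = mset (map z' (blist N I k))" "i \<in> {1..N}"
    then show "z i = z' i" by (intro eq_on_blocks[of z N I z'] sorted_mset_unique) auto
  qed (simp_all add: Des_subset_iff_blk block_sorted_exists del: mset_map)
  ultimately show ?thesis by simp
qed

section \<open>From containment to equality of descent sets\<close>

text \<open>Inclusion-exclusion as an induction on \<open>K\<close>: the count for containment in
  \<open>K\<close> splits over exact values, and the terms of proper subsets cancel by the induction
  hypothesis.\<close>

lemma card_eq_from_card_subset:
  assumes "finite X" "finite Y" "finite K"
    and le: "\<And>L. card {x \<in> X. f x \<subseteq> L} = card {y \<in> Y. g y \<subseteq> L}"
  shows "card {x \<in> X. f x = K} = card {y \<in> Y. g y = K}"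
  using assms(3)
proof (induction K rule: finite_psubset_induct)
  case (psubset K)
  have split: "card {x \<in> X. f x \<subseteq> K} = card {x \<in> X. f x = K} + (\<Sum>L\<in>Pow K - {K}. card {x \<in> X. f x = L})"
    if "finite X" for X :: "'z set" and f :: "'z \<Rightarrow> 'c set"
  proof -
    have "{x \<in> X. f x \<subseteq> K} = (\<Union>L\<in>Pow K. {x \<in> X. f x = L})" by auto
    then have "card {x \<in> X. f x \<subseteq> K} = (\<Sum>L\<in>Pow K. card {x \<in> X. f x = L})"
      using that psubset.hyps by (simp only:) (rule card_UN_disjoint, auto)
    then show ?thesis using psubset.hyps by (simp add: sum.remove[of "Pow K" K])
  qed
  have "(\<Sum>L\<in>Pow K - {K}. card {x \<in> X. f x = L}) = (\<Sum>L\<in>Pow K - {K}. card {y \<in> Y. g y = L})"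
    by (rule sum.cong) (auto intro: psubset.IH)
  then show ?case using split[OF assms(1), of f] split[OF assms(2), of g] le[of K] by simp
qed

lemma Plus_eq_iff: "A <+> B = C <+> D \<longleftrightarrow> A = C \<and> B = D"
  by blast

lemma Dinv_eq: "Dinv N J = {\<sigma>. \<sigma> permutes {1..N} \<and> Des N (inv \<sigma>) = J}"
proof (intro equalityI subsetI)
  fix \<sigma> assume "\<sigma> \<in> Dinv N J"
  then show "\<sigma> \<in> {\<sigma>. \<sigma> permutes {1..N} \<and> Des N (inv \<sigma>) = J}"
    by (auto simp: Dinv_def Dset_def permutes_inv permutes_inv_inv)
next
  fix \<sigma> assume "\<sigma> \<in> {\<sigma>. \<sigma> permutes {1..N} \<and> Des N (inv \<sigma>) = J}"
  then have "inv \<sigma> \<in> Dset N J" "\<sigma> = inv (inv \<sigma>)"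
    by (auto simp: Dset_def permutes_inv permutes_inv_inv)
  then show "\<sigma> \<in> Dinv N J" unfolding Dinv_def by blast
qed

text \<open>The descent sets of \<open>inv \<sigma>\<close> and of the permutation counted are
  packed into one disjoint sum, so a single inclusion-exclusion turns both containments into
  equalities.\<close>

lemma card_Dinv_Des_recut:
  assumes "p \<in> {1..N}"
  shows "card {\<sigma> \<in> Dinv N J. Des N (recut (Suc N) p \<sigma>) = I} = card {\<sigma> \<in> Dinv N J. Des N \<sigma> = I}"
proof (cases "finite J \<and> finite I")
  case True
  let ?S = "{\<sigma>. \<sigma> permutes {1..N}}"
  have fin: "finite ?S" by (rule finite_permutations) simp
  \<comment> \<open>Containment of a disjoint sum in an arbitrary \<open>L\<close> splits into one
    containment for each summand.\<close>
  have *: "{\<sigma> \<in> ?S. Des N (inv \<sigma>) <+> h \<sigma> \<subseteq> L} = {\<sigma> \<in> invdes N (Inl -` L). h \<sigma> \<subseteq> Inr -` L}"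
    for h :: "(nat \<Rightarrow> nat) \<Rightarrow> nat set" and L
    by (auto simp: invdes_def Plus_def)
  have "card {\<sigma> \<in> ?S. Des N (inv \<sigma>) <+> Des N (recut (Suc N) p \<sigma>) = J <+> I}
      = card {\<sigma> \<in> ?S. Des N (inv \<sigma>) <+> Des N \<sigma> = J <+> I}"
    by (rule card_eq_from_card_subset[OF fin fin])
      (use True in \<open>auto simp only: * card_invdes_Des_recut[OF assms] finite_Plus\<close>)
  then show ?thesis by (simp add: Plus_eq_iff Dinv_eq conj_assoc)
next
  case False
  have "finite (Des N w)" for w by (simp add: Des_def)
  then have "{\<sigma> \<in> Dinv N J. Des N (h \<sigma>) = I} = {}" for h
    using False by (auto simp: Dinv_eq)
  from this[of "recut (Suc N) p"] this[of "\<lambda>\<sigma>. \<sigma>"] show ?thesis by (simp only:)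
qed

lemma sum_by_fibres:
  fixes g :: "'b \<Rightarrow> 'a::comm_ring_1"
  assumes "finite A" "\<And>K. card {s \<in> A. h s = K} = card {s \<in> A. k s = K}"
  shows "(\<Sum>s\<in>A. g (h s)) = (\<Sum>s\<in>A. g (k s))"
proof -
  let ?T = "h ` A \<union> k ` A"
  have "(\<Sum>s\<in>A. g (f s)) = (\<Sum>K\<in>?T. of_nat (card {s \<in> A. f s = K}) * g K)"
    if "f ` A \<subseteq> ?T" for f
  proof -
    have "(\<Sum>s\<in>A. g (f s)) = (\<Sum>K\<in>?T. \<Sum>s\<in>{s \<in> A. f s = K}. g (f s))"
      using assms(1) that by (intro sum.group[symmetric]) auto
    also have "\<dots> = (\<Sum>K\<in>?T. of_nat (card {s \<in> A. f s = K}) * g K)"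
      by (rule sum.cong) auto
    finally show ?thesis .
  qed
  from this[of h] this[of k] show ?thesis using assms(2) by simp
qed

text \<open>Both rotations are trivial, because \<open>\<sigma>\<close> fixes \<open>Suc N\<close>.
  This settles the last position, which lies outside the range \<open>{1..N}\<close> of the count
  above.\<close>

lemma recut_self:
  assumes "\<sigma> permutes {1..N}"
  shows "recut (Suc N) (Suc N) \<sigma> = \<sigma>"
  using permutes_not_in[OF assms, of "Suc N"] by (simp add: recut_def cyc_pow_self del: funpow.simps(2))

lemma finite_Dinv: "finite (Dinv N J)"
  unfolding Dinv_eq by (rule finite_subset[OF _ finite_permutations[of "{1..N}"]]) auto

lemma sum_Des_recut:
  fixes g :: "nat set \<Rightarrow> 'a::comm_ring_1"
  assumes "p \<in> {1..Suc N}"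
  shows "(\<Sum>\<sigma>\<in>Dinv N J. g (Des N (recut (Suc N) p \<sigma>))) = (\<Sum>\<sigma>\<in>Dinv N J. g (Des N \<sigma>))"
proof (cases "p = Suc N")
  case True
  then show ?thesis by (intro sum.cong) (auto simp: recut_self Dinv_eq)
next
  case False
  then have "p \<in> {1..N}" using assms by auto
  then show ?thesis by (intro sum_by_fibres finite_Dinv card_Dinv_Des_recut)
qed

section \<open>Cyclic descents and the products with the cyclic group\<close>

lemma cDes_rotate:
  assumes "1 \<le> n"
  shows "cDes n (w \<circ> (cyc n ^^ k)) = {i \<in> {1..n}. (cyc n ^^ k) i \<in> cDes n w}"
proof -
  \<comment> \<open>In this form the cyclic successor is \<open>cyc n i\<close>, and powers of
    \<open>cyc n\<close> commute with \<open>cyc n\<close>.\<close>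
  have cD: "cDes n w = {i \<in> {1..n}. w (cyc n i) < w i}" for w
    by (auto simp: cDes_def cyc_def)
  show ?thesis
    using permutes_in_image[OF cyc_pow_permutes[OF assms, of k]]
    by (auto simp: cD funpow_swap1)
qed

text \<open>The largest value stands last: it makes \<open>Suc N\<close> a cyclic descent and
  \<open>N\<close> an ascent.\<close>

lemma cDes_eq_insert_Des:
  assumes "w permutes {1..N}" "1 \<le> N"
  shows "cDes (Suc N) w = insert (Suc N) (Des N w)"
proof -
  have n: "w (Suc N) = Suc N" using permutes_not_in[OF assms(1)] by simp
  have r: "w i \<in> {1..N}" if "i \<in> {1..N}" for i using permutes_in_image[OF assms(1)] that by simp
  have "i \<in> cDes (Suc N) w \<longleftrightarrow> i \<in> insert (Suc N) (Des N w)" for i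
  proof -
    consider "i = Suc N" | "i = N" | "i < N" | "i > Suc N" by linarith
    then show ?thesis
      by cases (use n r[of 1] r[of N] assms(2) in \<open>auto simp: cDes_def Des_def\<close>)
  qed
  then show ?thesis by blast
qed

lemma rotated_at:
  assumes "w permutes {1..N}" "p \<in> {1..Suc N}"
  shows "(w \<circ> (cyc (Suc N) ^^ (Suc N - p))) p = Suc N"
  using assms(2) permutes_not_in[OF assms(1), of "Suc N"] by (simp add: cyc_pow)

lemma rotated_permutes:
  assumes "w permutes {1..N}"
  shows "(w \<circ> (cyc (Suc N) ^^ k)) permutes {1..Suc N}"
  by (intro permutes_compose cyc_pow_permutes permutes_Suc assms) simp

text \<open>For fixed \<open>p\<close> the weight depends on \<open>w\<close> only through
  \<open>Des N w\<close>, which reduces the theorem to an equidistribution of descent sets.\<close>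

lemma weight_rotated:
  assumes "w permutes {1..N}" "1 \<le> N" "p \<in> {1..Suc N}"
  shows "xmon x (cDes (Suc N) (w \<circ> (cyc (Suc N) ^^ (Suc N - p)))) *
      t ^ (inv (w \<circ> (cyc (Suc N) ^^ (Suc N - p))) (Suc N))
    = xmon x {i \<in> {1..Suc N}. (cyc (Suc N) ^^ (Suc N - p)) i \<in> insert (Suc N) (Des N w)} * t ^ p"
proof -
  have "inv (w \<circ> (cyc (Suc N) ^^ (Suc N - p))) (Suc N) = p"
    using rotated_at[OF assms(1,3)] rotated_permutes[OF assms(1)]
    by (metis permutes_inverses(2))
  moreover have "cDes (Suc N) (w \<circ> (cyc (Suc N) ^^ (Suc N - p)))
    = {i \<in> {1..Suc N}. (cyc (Suc N) ^^ (Suc N - p)) i \<in> insert (Suc N) (Des N w)}"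
    using cDes_rotate[of "Suc N" w "Suc N - p"] cDes_eq_insert_Des[OF assms(1,2)] by simp
  ultimately show ?thesis by (simp only:)
qed

text \<open>The position of the largest entry recovers \<open>p\<close>, and then the rotation can
  be cancelled.\<close>

lemma rotated_inject:
  assumes "w permutes {1..N}" "w' permutes {1..N}" "p \<in> {1..Suc N}" "p' \<in> {1..Suc N}"
    and eq: "w \<circ> (cyc (Suc N) ^^ (Suc N - p)) = w' \<circ> (cyc (Suc N) ^^ (Suc N - p'))"
  shows "p = p' \<and> w = w'"
proof -
  have "inj (w \<circ> (cyc (Suc N) ^^ (Suc N - p)))"
    by (rule permutes_inj[OF rotated_permutes[OF assms(1)]])
  moreover have "(w \<circ> (cyc (Suc N) ^^ (Suc N - p))) p = (w \<circ> (cyc (Suc N) ^^ (Suc N - p))) p'"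
    using rotated_at[OF assms(1,3)] rotated_at[OF assms(2,4)] eq by simp
  ultimately have p: "p = p'" by (rule injD)
  have "surj (cyc (Suc N) ^^ (Suc N - p))" by (rule permutes_surj[OF cyc_pow_permutes]) simp
  then have "w = w'" using eq unfolding p by (metis surj_fun_eq)
  then show ?thesis using p by simp
qed

lemma recut_rotated:
  assumes "p \<in> {1..Suc N}"
  shows "recut (Suc N) p \<sigma> \<circ> (cyc (Suc N) ^^ (Suc N - p)) = (cyc (Suc N) ^^ (Suc N - \<sigma> p)) \<circ> \<sigma>"
proof -
  have "(cyc (Suc N) ^^ p) \<circ> (cyc (Suc N) ^^ (Suc N - p)) = cyc (Suc N) ^^ (p + (Suc N - p))"
    by (rule funpow_add[symmetric])
  also have "\<dots> = id" using assms cyc_pow_self[of "Suc N"] by (simp del: funpow.simps)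
  finally show ?thesis by (simp add: recut_def comp_assoc del: funpow.simps)
qed

lemma recut_inject:
  assumes "\<sigma> permutes {1..N}" "\<tau> permutes {1..N}" "p \<in> {1..Suc N}"
    and eq: "recut (Suc N) p \<sigma> = recut (Suc N) p \<tau>"
  shows "\<sigma> = \<tau>"
proof -
  let ?c = "cyc (Suc N)"
  have e: "(?c ^^ (Suc N - \<sigma> p)) \<circ> \<sigma> = (?c ^^ (Suc N - \<tau> p)) \<circ> \<tau>"
    using recut_rotated[OF assms(3)] eq by metis
  have r: "\<sigma> p \<in> {1..Suc N}" "\<tau> p \<in> {1..Suc N}"
    using permutes_in_image[OF permutes_Suc] assms by auto
  \<comment> \<open>Evaluation at \<open>Suc N\<close>, fixed by both permutations, compares the
    left rotations alone and so recovers \<open>\<sigma> p\<close>.\<close>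
  have "(?c ^^ (Suc N - \<sigma> p)) (Suc N) = (?c ^^ (Suc N - \<tau> p)) (Suc N)"
    using fun_cong[OF e, of "Suc N"] permutes_not_in[OF assms(1), of "Suc N"]
      permutes_not_in[OF assms(2), of "Suc N"] by simp
  then have "\<sigma> p = \<tau> p" using r by (auto simp: cyc_pow split: if_splits)
  moreover have "inj (?c ^^ (Suc N - \<sigma> p))" by (rule permutes_inj[OF cyc_pow_permutes]) simp
  ultimately show ?thesis using e by (simp add: fun_eq_iff inj_eq)
qed

lemma lmul_right:
  "lmul A (cycgrp (Suc N)) = (\<lambda>(p, \<sigma>). \<sigma> \<circ> (cyc (Suc N) ^^ (Suc N - p))) ` ({1..Suc N} \<times> A)"
proof (intro equalityI subsetI)
  fix w assume "w \<in> lmul A (cycgrp (Suc N))"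
  then obtain \<sigma> k where k: "\<sigma> \<in> A" "k < Suc N" "w = \<sigma> \<circ> (cyc (Suc N) ^^ k)"
    by (auto simp: lmul_def cycgrp_def)
  then show "w \<in> (\<lambda>(p, \<sigma>). \<sigma> \<circ> (cyc (Suc N) ^^ (Suc N - p))) ` ({1..Suc N} \<times> A)"
    by (intro image_eqI[of _ _ "(Suc N - k, \<sigma>)"]) auto
next
  fix w assume "w \<in> (\<lambda>(p, \<sigma>). \<sigma> \<circ> (cyc (Suc N) ^^ (Suc N - p))) ` ({1..Suc N} \<times> A)"
  then obtain p \<sigma> where p: "p \<in> {1..Suc N}" "\<sigma> \<in> A" "w = \<sigma> \<circ> (cyc (Suc N) ^^ (Suc N - p))" by auto
  moreover have "cyc (Suc N) ^^ (Suc N - p) \<in> cycgrp (Suc N)" using p unfolding cycgrp_def by force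
  ultimately show "w \<in> lmul A (cycgrp (Suc N))" unfolding lmul_def by blast
qed

lemma lmul_left:
  assumes A: "\<And>\<sigma>. \<sigma> \<in> A \<Longrightarrow> \<sigma> permutes {1..N}"
  shows "lmul (cycgrp (Suc N)) A =
    (\<lambda>(p, \<sigma>). recut (Suc N) p \<sigma> \<circ> (cyc (Suc N) ^^ (Suc N - p))) ` ({1..Suc N} \<times> A)"
proof (intro equalityI subsetI)
  fix w assume "w \<in> lmul (cycgrp (Suc N)) A"
  then obtain \<sigma> k where k: "\<sigma> \<in> A" "k < Suc N" "w = (cyc (Suc N) ^^ k) \<circ> \<sigma>"
    by (auto simp: lmul_def cycgrp_def)
  have s: "\<sigma> permutes {1..Suc N}" using A k permutes_Suc by blast
  \<comment> \<open>This is the position where \<open>w\<close> has the entry \<open>Suc N\<close>,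
    since the rotation by \<open>k\<close> takes \<open>Suc N - k\<close> there.\<close>
  define p where "p = inv \<sigma> (Suc N - k)"
  have p: "p \<in> {1..Suc N}" "Suc N - \<sigma> p = k"
    using permutes_in_image[OF permutes_inv[OF s]] k permutes_inverses[OF s] by (auto simp: p_def)
  then have "w = recut (Suc N) p \<sigma> \<circ> (cyc (Suc N) ^^ (Suc N - p))"
    by (simp only: recut_rotated k)
  then show "w \<in> (\<lambda>(p, \<sigma>). recut (Suc N) p \<sigma> \<circ> (cyc (Suc N) ^^ (Suc N - p))) ` ({1..Suc N} \<times> A)"
    using p k by (intro image_eqI[of _ _ "(p, \<sigma>)"]) auto
next
  fix w assume "w \<in> (\<lambda>(p, \<sigma>). recut (Suc N) p \<sigma> \<circ> (cyc (Suc N) ^^ (Suc N - p))) ` ({1..Suc N} \<times> A)"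
  then obtain p \<sigma> where p: "p \<in> {1..Suc N}" "\<sigma> \<in> A" "w = (cyc (Suc N) ^^ (Suc N - \<sigma> p)) \<circ> \<sigma>"
    using recut_rotated by force
  have "\<sigma> p \<in> {1..Suc N}" using permutes_in_image[OF permutes_Suc[OF A]] p by blast
  then have "cyc (Suc N) ^^ (Suc N - \<sigma> p) \<in> cycgrp (Suc N)" unfolding cycgrp_def by force
  then show "w \<in> lmul (cycgrp (Suc N)) A" using p unfolding lmul_def by blast
qed

section \<open>Equality of the two generating sums\<close>

theorem theorem4p1:
  fixes n :: nat and J :: "nat set" and x :: "nat \<Rightarrow> 'a::comm_ring_1" and t :: 'a
  assumes "n \<ge> 1" and "J \<subseteq> {1..n-2}"
  shows "(\<Sum>p\<in>lmul (cycgrp n) (Dinv (n-1) J). xmon x (cDes n p) * t ^ (inv p n))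
       = (\<Sum>p\<in>lmul (Dinv (n-1) J) (cycgrp n). xmon x (cDes n p) * t ^ (inv p n))"
proof (cases "n = 1")
  case True
  \<comment> \<open>The group is trivial here, so the two products are the same set.\<close>
  then have "cycgrp n = {id}" by (auto simp: cycgrp_def)
  then show ?thesis by (simp add: lmul_def)
next
  case False
  then obtain N where n: "n = Suc N" and N: "1 \<le> N" using assms(1) by (cases n) auto
  define A where "A = Dinv N J"
  define wt where "wt w = xmon x (cDes n w) * t ^ (inv w n)" for w
  \<comment> \<open>The weight of a product with largest entry at \<open>p\<close>, as a function of
    the descent set alone.\<close>
  define g where "g p D = xmon x {i \<in> {1..n}. (cyc n ^^ (n - p)) i \<in> insert n D} * t ^ p" for p D
  have A: "\<sigma> permutes {1..N}" if "\<sigma> \<in> A" for \<sigma> using that by (simp add: A_def Dinv_eq)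
  have wt: "wt (w \<circ> (cyc n ^^ (n - p))) = g p (Des N w)"
    if "w permutes {1..N}" "p \<in> {1..n}" for w p
    using weight_rotated[OF that(1) N that(2)[unfolded n], of x t] by (simp add: wt_def g_def n)
  have rp: "recut n p \<sigma> permutes {1..N}" if "\<sigma> \<in> A" "p \<in> {1..n}" for \<sigma> p
    using that A recut_permutes n by blast
  have "inj_on (\<lambda>(p, \<sigma>). recut n p \<sigma> \<circ> (cyc n ^^ (n - p))) ({1..n} \<times> A)"
  proof (rule inj_onI, clarify)
    fix p \<sigma> p' \<sigma>' assume *: "p \<in> {1..n}" "p' \<in> {1..n}" "\<sigma> \<in> A" "\<sigma>' \<in> A"
      "recut n p \<sigma> \<circ> (cyc n ^^ (n - p)) = recut n p' \<sigma>' \<circ> (cyc n ^^ (n - p'))"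
    then have "p = p' \<and> recut n p \<sigma> = recut n p' \<sigma>'" using rp rotated_inject n by blast
    then show "p = p' \<and> \<sigma> = \<sigma>'" using * A recut_inject n by blast
  qed
  then have "sum wt (lmul (cycgrp n) A) = (\<Sum>(p, \<sigma>)\<in>{1..n} \<times> A. wt (recut n p \<sigma> \<circ> (cyc n ^^ (n - p))))"
    using lmul_left[of A N] A n by (simp add: sum.reindex case_prod_unfold)
  also have "\<dots> = (\<Sum>p\<in>{1..n}. \<Sum>\<sigma>\<in>A. g p (Des N (recut n p \<sigma>)))"
    unfolding sum.cartesian_product[symmetric] by (intro sum.cong refl wt rp)
  \<comment> \<open>The equidistribution is applied for each \<open>p\<close> separately, which
    keeps the power of \<open>t\<close> fixed.\<close>
  also have "\<dots> = (\<Sum>p\<in>{1..n}. \<Sum>\<sigma>\<in>A. g p (Des N \<sigma>))"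
    unfolding A_def n by (intro sum.cong refl sum_Des_recut)
  also have "\<dots> = (\<Sum>(p, \<sigma>)\<in>{1..n} \<times> A. wt (\<sigma> \<circ> (cyc n ^^ (n - p))))"
    unfolding sum.cartesian_product[symmetric] by (intro sum.cong refl wt[symmetric] A)
  also have "\<dots> = sum wt (lmul A (cycgrp n))"
  proof -
    have "inj_on (\<lambda>(p, \<sigma>). \<sigma> \<circ> (cyc n ^^ (n - p))) ({1..n} \<times> A)"
    proof (rule inj_onI, clarify)
      fix p \<sigma> p' \<sigma>' assume *: "p \<in> {1..n}" "p' \<in> {1..n}" "\<sigma> \<in> A" "\<sigma>' \<in> A"
        "\<sigma> \<circ> (cyc n ^^ (n - p)) = \<sigma>' \<circ> (cyc n ^^ (n - p'))"
      then show "p = p' \<and> \<sigma> = \<sigma>'" using A rotated_inject n by blast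
    qed
    then show ?thesis using lmul_right[of A N] n by (simp add: sum.reindex case_prod_unfold)
  qed
  finally show ?thesis by (simp add: wt_def A_def n)
qed

end
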